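(* Let $\mathcal S,\mathcal B\subset\mathbb R^p$ be bounded closed convex polytopes with non-empty interior. The inner approximation algorithm with initial approximation $\mathcal S$, using a plane separating oracle $\mathsf{hpO}(\mathcal B)$ for $\mathcal B$, terminates with $\mathcal R=\mathsf{conv}(\mathcal B\cup\mathcal S)$, the convex hull of $\mathcal B$ and $\mathcal S$. The algorithm makes at most $v+f$ oracle calls, where $v$ is the number of vertices of $\mathcal B$ and $f$ is the number of facets of $\mathcal R$.
   Context: A halfspace in $\mathbb R^p$ is a set $H=\{y\in\mathbb R^p: yh\ge M\}$, where $h\in\mathbb R^p$ is a non-null vector, $M\in\mathbb R$, and $yh$ is the inner product. The negative side of $H$ is the open halfspace $\{y: yh<M\}$. A facet of a full-dimensional polytope in $\mathbb R^p$ is a face of dimension $p-1$; each facet is identified with the halfspace which contains the polytope and whose bounding hyperplane intersects the polytope in that facet. Plane separating oracle $\mathsf{hpO}(\mathcal B)$: a black box which on input a halfspace $H\subset\mathbb R^p$ returns "inside" if $\mathcal B\subseteq H$; otherwise it returns a vertex $v$ of $\mathcal B$ on the negative side of $H$ (any such vertex is an allowed answer). Inner approximation algorithm: Set $\mathcal S_0=\mathcal S$. In each approximation certain facets are marked "final"; initially no facet is marked. Consider the $i$-th approximation $\mathcal S_i$. If all facets of $\mathcal S_i$ are final, stop with result $\mathcal R=\mathcal S_i$. Otherwise pick any non-final facet $H_i$ of $\mathcal S_i$ and call the oracle with (the halfspace corresponding to) $H_i$. If the oracle returns "inside", mark $H_i$ as final and repeat. Otherwise the oracle returns a point $v_i$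 of $\mathcal B$ on the negative side of $H_i$; let $\mathcal S_{i+1}$ be the convex hull of $\mathcal S_i$ and $v_i$, keep the "final" flag on previous facets, and repeat. The statement holds for every choice of the picked facets and for all admissible oracle answers. *)

theory Defs
  imports "HOL-Analysis.Analysis"
begin

definition halfspace :: "'a::euclidean_space set \<Rightarrow> bool" where
  "halfspace H \<longleftrightarrow> (\<exists>h M. h \<noteq> 0 \<and> H = {y. y \<bullet> h \<ge> M})"

text \<open>The pair \<open>(h, M)\<close> describing a halfspace is unique only up to a positive factor, so the
  negative side is defined from the point set itself.\<close>

definition negative_side :: "'a::euclidean_space set \<Rightarrow> 'a set" where
  "negative_side H = - H"

lemma negative_side_halfspace: "negative_side {y. y \<bullet> h \<ge> M} = {y. y \<bullet> h < M}"
  by (auto simp: negative_side_def)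

definition facet_halfspaces :: "'a::euclidean_space set \<Rightarrow> 'a set set" where
  "facet_halfspaces S = {H. \<exists>h M. h \<noteq> 0 \<and> H = {y. y \<bullet> h \<ge> M} \<and> S \<subseteq> H \<and>
                              (S \<inter> {y. y \<bullet> h = M}) facet_of S}"

lemma halfspace_facet_halfspaces: "H \<in> facet_halfspaces S \<Longrightarrow> halfspace H"
  by (auto simp: facet_halfspaces_def halfspace_def)

datatype 'a answer = Inside | Vertex 'a

text \<open>The oracle is a relation rather than a function: \<open>hpO B H a\<close> says that \<open>a\<close> is an admissible
  answer to the query \<open>H\<close>, so repeated queries need not be answered consistently.\<close>

fun hpO :: "'a::euclidean_space set \<Rightarrow> 'a set \<Rightarrow> 'a answer \<Rightarrow> bool" where
  "hpO B H Inside \<longleftrightarrow> halfspace H \<and> B \<subseteq> H"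
| "hpO B H (Vertex v) \<longleftrightarrow> halfspace H \<and> \<not> B \<subseteq> H \<and> v extreme_point_of B \<and> v \<in> negative_side H"

text \<open>A state consists of the current approximation and the set of facets marked final. A mark is
  attached to the halfspace of a facet and not to its point set, because the latter may grow when
  the added vertex lies on the bounding hyperplane. Every step makes exactly one oracle call.\<close>

type_synonym 'a state = "'a set \<times> 'a set set"

inductive approx_step :: "'a::euclidean_space set \<Rightarrow> 'a state \<Rightarrow> 'a state \<Rightarrow> bool" for B where
  mark_final:
    "\<lbrakk>H \<in> facet_halfspaces S; H \<notin> F; hpO B H Inside\<rbrakk>
      \<Longrightarrow> approx_step B (S, F) (S, insert H F)"
| add_vertex:
    "\<lbrakk>H \<in> facet_halfspaces S; H \<notin> F; hpO B H (Vertex v)\<rbrakk>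
      \<Longrightarrow> approx_step B (S, F) (convex hull (insert v S), F)"

definition initial_state :: "'a::euclidean_space set \<Rightarrow> 'a state" where
  "initial_state S = (S, {})"

definition stopped :: "'a::euclidean_space state \<Rightarrow> bool" where
  "stopped st \<longleftrightarrow> facet_halfspaces (fst st) \<subseteq> snd st"

end

theory Submission
  imports Defs
begin

text \<open>Let \<open>R = convex hull (B \<union> S)\<close>. Every approximation \<open>T\<close> satisfies \<open>S \<subseteq> T \<subseteq> R\<close>. The run is
  controlled by charging each oracle call to one of two finite supplies.

  A call answered by a vertex \<open>v\<close> of \<open>B\<close> is charged to \<open>v\<close>: since \<open>T\<close> lies in the queried halfspace
  and \<open>v\<close> does not, \<open>v\<close> is outside \<open>T\<close> and inside every later approximation, so no vertex is charged
  twice. A call answered ``inside'' is charged to a facet of \<open>R\<close>: the queried halfspace \<open>H\<close> contains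
  both \<open>B\<close> and \<open>S\<close>, hence \<open>R\<close>, while the bounding hyperplane meets already the smaller body \<open>T\<close> in
  dimension \<open>p - 1\<close>; so \<open>H\<close> supports \<open>R\<close> in a facet (\<open>facet_halfspaces_superset\<close>). Distinct
  halfspaces support distinct facets (\<open>card_facet_halfspaces_le\<close>), and a marked halfspace is not
  queried again. Thus the number of calls is at most the number of vertices of \<open>B\<close> in \<open>T\<close> plus the
  number of marks, which is the invariant \<open>run_invariant\<close>; it yields the bound and, with it,
  termination.

  When all facets of \<open>T\<close> are marked, \<open>R\<close> lies in every facet halfspace of \<open>T\<close>. The facets cover the
  frontier of \<open>T\<close>, so no frontier point of \<open>T\<close> is interior to \<open>R\<close>. A segment from an interior
  point of \<open>T\<close> to a point of \<open>R - T\<close> would have to cross the frontier of \<open>T\<close> at a point interior to \<open>R\<close>; hence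
  \<open>T = R\<close> (\<open>eq_if_facet_halfspaces_contain\<close>).\<close>

section \<open>Facet halfspaces of full-dimensional convex bodies\<close>

text \<open>The segment from a common interior point to a point of \<open>K\<close> outside \<open>T\<close> runs inside the interior
  of \<open>K\<close>, endpoint possibly excepted, and has to leave \<open>T\<close> somewhere before that endpoint.\<close>

lemma convex_subset_closed_if_frontier_disjoint:
  fixes T K :: "'a::euclidean_space set"
  assumes "closed T" "convex K" and z: "z \<in> interior T" "z \<in> interior K"
    and disj: "frontier T \<inter> interior K = {}"
  shows "K \<subseteq> T"
proof
  fix x assume x: "x \<in> K"
  show "x \<in> T"
  proof (rule ccontr)
    assume nx: "x \<notin> T"
    have "closed_segment z x \<inter> frontier T \<noteq> {}"
      using nx z(1) interior_subset by (intro connected_Int_frontier) auto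
    then obtain y where y: "y \<in> closed_segment z x" "y \<in> frontier T" by blast
    have "y \<noteq> z" using y(2) z(1) by (auto simp: frontier_def)
    moreover have "y \<noteq> x" using y(2) nx \<open>closed T\<close> by (auto simp: frontier_def)
    ultimately have "y \<in> open_segment z x" using y(1) by (simp add: open_segment_def)
    moreover have "open_segment z x \<subseteq> interior K"
      using in_interior_closure_convex_segment[OF \<open>convex K\<close> z(2)] x closure_subset by blast
    ultimately show False using y(2) disj by blast
  qed
qed

lemma frontier_halfspace_inner_ge:
  fixes h :: "'a::euclidean_space"
  assumes "h \<noteq> 0"
  shows "frontier {y. y \<bullet> h \<ge> M} = {y. y \<bullet> h = M}"
  using frontier_halfspace_ge[of h M] assms by (simp add: inner_commute)

lemma closed_halfspace: "halfspace H \<Longrightarrow> closed H"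
  by (auto simp: halfspace_def closed_halfspace_ge inner_commute)

lemma convex_halfspace: "halfspace H \<Longrightarrow> convex H"
  by (auto simp: halfspace_def convex_halfspace_ge inner_commute)

text \<open>The bounding hyperplane of a halfspace is its frontier, which frees facet halfspaces from the
  choice of a normal and an offset.\<close>

lemma facet_halfspaces_iff:
  "H \<in> facet_halfspaces T \<longleftrightarrow> halfspace H \<and> T \<subseteq> H \<and> (T \<inter> frontier H) facet_of T"
proof
  assume "H \<in> facet_halfspaces T"
  then obtain h M where hM: "h \<noteq> 0" "H = {y. y \<bullet> h \<ge> M}" "T \<subseteq> H" "(T \<inter> {y. y \<bullet> h = M}) facet_of T"
    by (auto simp: facet_halfspaces_def)
  moreover have "frontier H = {y. y \<bullet> h = M}"
    unfolding hM(2) using hM(1) by (rule frontier_halfspace_inner_ge)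
  ultimately show "halfspace H \<and> T \<subseteq> H \<and> (T \<inter> frontier H) facet_of T"
    unfolding halfspace_def by auto
next
  assume H: "halfspace H \<and> T \<subseteq> H \<and> (T \<inter> frontier H) facet_of T"
  then obtain h M where hM: "h \<noteq> 0" "H = {y. y \<bullet> h \<ge> M}"
    by (auto simp: halfspace_def)
  moreover have "frontier H = {y. y \<bullet> h = M}"
    unfolding hM(2) using hM(1) by (rule frontier_halfspace_inner_ge)
  ultimately show "H \<in> facet_halfspaces T"
    using H unfolding facet_halfspaces_def by auto
qed

lemma affine_frontier_halfspace:
  fixes H :: "'a::euclidean_space set"
  assumes "halfspace H"
  shows "affine (frontier H)" and "aff_dim (frontier H) = int DIM('a) - 1"
proof -
  obtain h M where "h \<noteq> 0" and Heq: "H = {y. y \<bullet> h \<ge> M}"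
    using assms by (auto simp: halfspace_def)
  have "frontier H = {y. y \<bullet> h = M}"
    unfolding Heq using \<open>h \<noteq> 0\<close> by (rule frontier_halfspace_inner_ge)
  then have "frontier H = {y. h \<bullet> y = M}" by (simp add: inner_commute)
  with \<open>h \<noteq> 0\<close> show "affine (frontier H)" and "aff_dim (frontier H) = int DIM('a) - 1"
    by (simp_all add: affine_hyperplane)
qed

lemma facet_aff_dim_full:
  fixes T :: "'a::euclidean_space set"
  assumes "G facet_of T" "interior T \<noteq> {}"
  shows "aff_dim G = int DIM('a) - 1"
  using assms by (simp add: facet_of_def aff_dim_nonempty_interior)

text \<open>Enlarging the body inside a facet halfspace keeps the halfspace supporting, and the face in
  which it supports can only grow. It already had codimension one, and as a subset of a hyperplane it
  cannot get a larger dimension.\<close>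

lemma facet_halfspaces_superset:
  fixes T R H :: "'a::euclidean_space set"
  assumes H: "H \<in> facet_halfspaces T" and T: "interior T \<noteq> {}"
    and "T \<subseteq> R" "R \<subseteq> H" "convex R"
  shows "H \<in> facet_halfspaces R"
proof -
  have hs: "halfspace H" and G: "(T \<inter> frontier H) facet_of T"
    using H by (auto simp: facet_halfspaces_iff)
  obtain h M where "h \<noteq> 0" and Heq: "H = {y. y \<bullet> h \<ge> M}" using hs by (auto simp: halfspace_def)
  have fr: "frontier H = {y. y \<bullet> h = M}" unfolding Heq by (rule frontier_halfspace_inner_ge) fact
  have "(R \<inter> {y. h \<bullet> y = M}) face_of R"
    using \<open>R \<subseteq> H\<close> by (intro face_of_Int_supporting_hyperplane_ge[OF \<open>convex R\<close>])
      (auto simp: Heq inner_commute)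
  then have face: "(R \<inter> frontier H) face_of R" by (simp add: fr inner_commute)
  have sub: "T \<inter> frontier H \<subseteq> R \<inter> frontier H" using \<open>T \<subseteq> R\<close> by blast
  have "int DIM('a) - 1 \<le> aff_dim (R \<inter> frontier H)"
    using aff_dim_subset[OF sub] facet_aff_dim_full[OF G T] by simp
  moreover have "aff_dim (R \<inter> frontier H) \<le> int DIM('a) - 1"
    using aff_dim_subset[of "R \<inter> frontier H" "frontier H"] affine_frontier_halfspace(2)[OF hs] by simp
  moreover have "aff_dim R = int DIM('a)"
    using T interior_mono[OF \<open>T \<subseteq> R\<close>] by (intro aff_dim_nonempty_interior) blast
  moreover have "R \<inter> frontier H \<noteq> {}" using G sub by (auto simp: facet_of_def)
  ultimately have "(R \<inter> frontier H) facet_of R" using face by (simp add: facet_of_def)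
  then show ?thesis using hs \<open>R \<subseteq> H\<close> by (simp add: facet_halfspaces_iff)
qed

lemma affine_hull_facet:
  fixes R :: "'a::euclidean_space set"
  assumes H: "H \<in> facet_halfspaces R" and R: "interior R \<noteq> {}"
  shows "affine hull (R \<inter> frontier H) = frontier H"
proof (rule affine_dim_equal)
  have hs: "halfspace H" and G: "(R \<inter> frontier H) facet_of R"
    using H by (auto simp: facet_halfspaces_iff)
  show "affine (frontier H)" using affine_frontier_halfspace(1)[OF hs] .
  then show "affine hull (R \<inter> frontier H) \<subseteq> frontier H" by (simp add: hull_minimal)
  show "affine hull (R \<inter> frontier H) \<noteq> {}" using G by (auto simp: facet_of_def)
  show "aff_dim (affine hull (R \<inter> frontier H)) = aff_dim (frontier H)"
    using facet_aff_dim_full[OF G R] affine_frontier_halfspace(2)[OF hs] by simp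
qed (rule affine_affine_hull)

text \<open>A facet spans its bounding hyperplane, and an interior point of \<open>R\<close> selects the side of the
  hyperplane: two such halfspaces have the same frontier and a common interior point, so each
  contains the other.\<close>

lemma inj_on_facet_of_halfspace:
  fixes R :: "'a::euclidean_space set"
  assumes R: "interior R \<noteq> {}"
  shows "inj_on (\<lambda>H. R \<inter> frontier H) (facet_halfspaces R)"
proof (rule inj_onI)
  fix H K
  assume H: "H \<in> facet_halfspaces R" and K: "K \<in> facet_halfspaces R"
    and eq: "R \<inter> frontier H = R \<inter> frontier K"
  have fr: "frontier H = frontier K"
    using affine_hull_facet[OF H R] affine_hull_facet[OF K R] eq by metis
  obtain z where "z \<in> interior R" using R by blast
  moreover have "R \<subseteq> H" "R \<subseteq> K" using H K by (simp_all add: facet_halfspaces_iff)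
  ultimately have z: "z \<in> interior H" "z \<in> interior K"
    using interior_mono[of R H] interior_mono[of R K] by blast+
  have "frontier H \<inter> interior H = {}" "frontier K \<inter> interior K = {}"
    by (auto simp: frontier_def)
  then have disj: "frontier H \<inter> interior K = {}" "frontier K \<inter> interior H = {}"
    by (simp_all only: fr)
  have "closed H" "convex H" "closed K" "convex K"
    using H K by (auto simp: facet_halfspaces_iff closed_halfspace convex_halfspace)
  then show "H = K"
    using convex_subset_closed_if_frontier_disjoint[of H K z]
      convex_subset_closed_if_frontier_disjoint[of K H z] z disj by simp
qed

lemma card_facet_halfspaces_le:
  fixes R :: "'a::euclidean_space set"
  assumes "polytope R" "interior R \<noteq> {}"
  shows "finite (facet_halfspaces R)"
    and "card (facet_halfspaces R) \<le> card {G. G facet_of R}"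
proof -
  have inj: "inj_on (\<lambda>H. R \<inter> frontier H) (facet_halfspaces R)"
    using assms(2) by (rule inj_on_facet_of_halfspace)
  have img: "(\<lambda>H. R \<inter> frontier H) ` facet_halfspaces R \<subseteq> {G. G facet_of R}"
    by (auto simp: facet_halfspaces_iff)
  have fin: "finite {G. G facet_of R}" using assms(1) by (rule finite_polytope_facets)
  show "finite (facet_halfspaces R)" using inj_on_finite[OF inj img fin] .
  show "card (facet_halfspaces R) \<le> card {G. G facet_of R}" using card_inj_on_le[OF inj img fin] .
qed

lemma facet_obtains_facet_halfspace:
  fixes T :: "'a::euclidean_space set"
  assumes "polyhedron T" "G facet_of T"
  obtains H where "H \<in> facet_halfspaces T" "G = T \<inter> frontier H"
proof -
  obtain a b where a: "a \<noteq> 0" "T \<subseteq> {x. a \<bullet> x \<le> b}" "G = T \<inter> {x. a \<bullet> x = b}"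
    by (rule facet_of_polyhedron[OF assms])
  \<comment> \<open>A facet halfspace is written with \<open>\<ge>\<close>, so the normal is reversed.\<close>
  let ?H = "{y. y \<bullet> (- a) \<ge> - b}"
  have fr: "frontier ?H = {y. y \<bullet> (- a) = - b}"
    using a(1) by (intro frontier_halfspace_inner_ge) simp
  have G: "G = T \<inter> frontier ?H" unfolding fr a(3) by (auto simp: inner_commute)
  have "halfspace ?H" using a(1) unfolding halfspace_def by (metis neg_equal_0_iff_equal)
  moreover have "T \<subseteq> ?H" using a(2) by (auto simp: inner_commute)
  ultimately have "?H \<in> facet_halfspaces T" using assms(2) G by (simp add: facet_halfspaces_iff)
  then show thesis using G that by blast
qed

text \<open>The frontier of \<open>T\<close> is covered by facets, each of which lies on the frontier of a halfspace
  around \<open>R\<close>; so the frontier of \<open>T\<close> misses the interior of \<open>R\<close>, and \<open>R\<close> cannot reach beyond \<open>T\<close>.\<close>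

lemma eq_if_facet_halfspaces_contain:
  fixes T R :: "'a::euclidean_space set"
  assumes T: "polytope T" "interior T \<noteq> {}" and "T \<subseteq> R" "convex R"
    and facets: "\<And>H. H \<in> facet_halfspaces T \<Longrightarrow> R \<subseteq> H"
  shows "T = R"
proof
  have pT: "polyhedron T" and clT: "closed T"
    using T(1) by (auto simp: polytope_imp_polyhedron polytope_imp_closed)
  obtain z where z: "z \<in> interior T" using T(2) by blast
  then have zR: "z \<in> interior R" using interior_mono[OF \<open>T \<subseteq> R\<close>] by blast
  have "y \<notin> interior R" if y: "y \<in> frontier T" for y
  proof -
    have "y \<in> T - rel_interior T"
      using y clT T(2) by (simp add: frontier_def rel_interior_nonempty_interior)
    then obtain G where "G facet_of T" "y \<in> G"
      using rel_boundary_of_polyhedron[OF pT] by auto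
    then obtain H where H: "H \<in> facet_halfspaces T" "y \<in> frontier H"
      using facet_obtains_facet_halfspace[OF pT] by blast
    then show ?thesis using interior_mono[OF facets[OF H(1)]] by (auto simp: frontier_def)
  qed
  then show "R \<subseteq> T"
    using convex_subset_closed_if_frontier_disjoint[OF clT \<open>convex R\<close> z zR] by blast
qed fact

section \<open>Runs of the algorithm\<close>

text \<open>Marked halfspaces are recorded as facet halfspaces of the final body, which does not change
  during the run, whereas the facets of the approximations do. The last conjunct is the charging scheme: vertices of \<open>B\<close> that have been swallowed and
  marks together pay for the calls. It is an inequality because \<open>S\<close> may contain vertices of \<open>B\<close> from
  the start and a hull may swallow several at once.\<close>

definition run_invariant ::
  "'a::euclidean_space set \<Rightarrow> 'a set \<Rightarrow> nat \<Rightarrow> 'a state \<Rightarrow> bool" where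
  "run_invariant B S n st \<longleftrightarrow> (case st of (T, F) \<Rightarrow>
     polytope T \<and> S \<subseteq> T \<and> T \<subseteq> convex hull (B \<union> S) \<and>
     F \<subseteq> facet_halfspaces (convex hull (B \<union> S)) \<and>
     n \<le> card {x. x extreme_point_of B \<and> x \<in> T} + card F)"

lemma polytope_convex_hull_Un:
  fixes B S :: "'a::euclidean_space set"
  assumes "polytope B" "polytope S"
  shows "polytope (convex hull (B \<union> S))"
proof -
  obtain V W where "finite V" "B = convex hull V" "finite W" "S = convex hull W"
    using assms by (auto simp: polytope_def)
  then show ?thesis
    unfolding polytope_def using hull_Un_left[of convex V W] hull_Un_right[of convex "convex hull V" W]
    by (intro exI[of _ "V \<union> W"]) simp
qed

lemma finite_extreme_points_polytope:
  fixes B :: "'a::euclidean_space set"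
  assumes "polytope B"
  shows "finite {x. x extreme_point_of B}"
  using assms finite_polyhedron_extreme_points polytope_imp_polyhedron by blast

lemma finite_facet_halfspaces_hull:
  fixes B S :: "'a::euclidean_space set"
  assumes "polytope B" "polytope S" "interior S \<noteq> {}"
  shows "finite (facet_halfspaces (convex hull (B \<union> S)))"
    and "card (facet_halfspaces (convex hull (B \<union> S))) \<le> card {G. G facet_of convex hull (B \<union> S)}"
proof -
  have "S \<subseteq> convex hull (B \<union> S)" using hull_subset[of "B \<union> S" convex] by blast
  then have "interior (convex hull (B \<union> S)) \<noteq> {}" using assms(3) interior_mono by blast
  then show "finite (facet_halfspaces (convex hull (B \<union> S)))"
    and "card (facet_halfspaces (convex hull (B \<union> S))) \<le> card {G. G facet_of convex hull (B \<union> S)}"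
    using card_facet_halfspaces_le polytope_convex_hull_Un[OF assms(1,2)] by blast+
qed

lemma run_invariant_step:
  fixes B S :: "'a::euclidean_space set"
  assumes B: "polytope B" and S: "polytope S" "interior S \<noteq> {}"
    and inv: "run_invariant B S n st" and step: "approx_step B st st'"
  shows "run_invariant B S (Suc n) st'"
  using step
proof cases
  case (mark_final H T F)
  let ?R = "convex hull (B \<union> S)"
  have T: "polytope T" "S \<subseteq> T" "T \<subseteq> ?R" and F: "F \<subseteq> facet_halfspaces ?R"
    and n: "n \<le> card {x. x extreme_point_of B \<and> x \<in> T} + card F"
    using inv mark_final by (auto simp: run_invariant_def)
  have "convex H" "B \<subseteq> H" "S \<subseteq> H"
    using mark_final T(2) by (auto simp: facet_halfspaces_iff convex_halfspace)
  then have "?R \<subseteq> H" by (simp add: hull_minimal)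
  moreover have "interior T \<noteq> {}" using S(2) interior_mono[OF T(2)] by blast
  ultimately have "H \<in> facet_halfspaces ?R"
    using facet_halfspaces_superset[of H T ?R] mark_final T(3) by simp
  moreover have "card (insert H F) = Suc (card F)"
    using finite_subset[OF F finite_facet_halfspaces_hull(1)[OF B S]] mark_final by simp
  ultimately show ?thesis using T F n mark_final by (simp add: run_invariant_def)
next
  case (add_vertex H T F v)
  let ?R = "convex hull (B \<union> S)" and ?T' = "convex hull (insert v T)"
  let ?V = "\<lambda>T. {x. x extreme_point_of B \<and> x \<in> T}"
  have T: "polytope T" "S \<subseteq> T" "T \<subseteq> ?R" and F: "F \<subseteq> facet_halfspaces ?R"
    and n: "n \<le> card (?V T) + card F"
    using inv add_vertex by (auto simp: run_invariant_def)
  have v: "v extreme_point_of B" "v \<notin> T"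
    using add_vertex by (auto simp: facet_halfspaces_iff negative_side_def)
  have "v \<in> ?R" using v(1) by (simp add: extreme_point_of_def hull_inc)
  then have "?T' \<subseteq> ?R" using T(3) by (simp add: hull_minimal)
  moreover have "polytope ?T'"
    using polytope_convex_hull_Un[of "{v}" T] T(1) by (simp add: polytope_sing)
  moreover have "insert v T \<subseteq> ?T'" by (rule hull_subset)
  moreover have "card (?V T) < card (?V ?T')"
  proof (rule psubset_card_mono)
    show "finite (?V ?T')" using finite_extreme_points_polytope[OF B] by simp
    show "?V T \<subset> ?V ?T'" using v \<open>insert v T \<subseteq> ?T'\<close> by blast
  qed
  ultimately show ?thesis using T F n add_vertex by (auto simp: run_invariant_def)
qed

lemma run_invariant_steps:
  fixes B S :: "'a::euclidean_space set"
  assumes "polytope B" "polytope S" "interior S \<noteq> {}"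
    and "(approx_step B ^^ n) (initial_state S) st"
  shows "run_invariant B S n st"
  using assms(4)
proof (induction n arbitrary: st)
  case 0
  have "S \<subseteq> convex hull (B \<union> S)" using hull_subset[of "B \<union> S" convex] by blast
  moreover have "st = (S, {})" using 0 by (simp add: initial_state_def)
  ultimately show ?case using assms(2) by (simp add: run_invariant_def)
next
  case (Suc n)
  then obtain st' where "(approx_step B ^^ n) (initial_state S) st'" "approx_step B st' st"
    by (meson relpowp_Suc_E)
  then show ?case using run_invariant_step[OF assms(1-3) Suc.IH] by blast
qed

lemma run_invariant_bound:
  fixes B S :: "'a::euclidean_space set"
  assumes "polytope B" "polytope S" "interior S \<noteq> {}" and inv: "run_invariant B S n st"
  shows "n \<le> card {x. x extreme_point_of B} + card {G. G facet_of (convex hull (B \<union> S))}"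
proof -
  obtain T F where st: "st = (T, F)" by fastforce
  have F: "F \<subseteq> facet_halfspaces (convex hull (B \<union> S))"
    and n: "n \<le> card {x. x extreme_point_of B \<and> x \<in> T} + card F"
    using inv st by (auto simp: run_invariant_def)
  have "card {x. x extreme_point_of B \<and> x \<in> T} \<le> card {x. x extreme_point_of B}"
    using finite_extreme_points_polytope[OF assms(1)] by (intro card_mono) auto
  moreover have "card F \<le> card {G. G facet_of (convex hull (B \<union> S))}"
    using card_mono[OF _ F] finite_facet_halfspaces_hull[OF assms(1-3)] by linarith
  ultimately show ?thesis using n by linarith
qed

text \<open>The oracle always has an admissible answer: \<open>B\<close> is the convex hull of its vertices, so if all
  of them lie in the convex set \<open>H\<close> then so does \<open>B\<close>.\<close>

lemma oracle_answers:
  fixes B H :: "'a::euclidean_space set"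
  assumes "polytope B" "halfspace H"
  shows "\<exists>a. hpO B H a"
proof (cases "B \<subseteq> H")
  case True
  then have "hpO B H Inside" using assms(2) by simp
  then show ?thesis ..
next
  case False
  have "B = convex hull {x. x extreme_point_of B}"
    using assms(1) by (intro Krein_Milman_Minkowski polytope_imp_compact polytope_imp_convex)
  then have "\<not> {x. x extreme_point_of B} \<subseteq> H"
    using False convex_halfspace[OF assms(2)] by (metis hull_minimal)
  then obtain v where "v extreme_point_of B" "v \<notin> H" by blast
  then have "hpO B H (Vertex v)" using False assms(2) by (simp add: negative_side_def)
  then show ?thesis ..
qed

lemma step_if_not_stopped:
  fixes B :: "'a::euclidean_space set"
  assumes "polytope B" "\<not> stopped st"
  shows "\<exists>st'. approx_step B st st'"
proof -
  obtain T F where st: "st = (T, F)" by fastforce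
  then obtain H where H: "H \<in> facet_halfspaces T" "H \<notin> F"
    using assms(2) by (auto simp: stopped_def)
  then obtain a where "hpO B H a"
    using oracle_answers[OF assms(1)] halfspace_facet_halfspaces by blast
  then show ?thesis using H st approx_step.intros by (cases a) blast+
qed

lemma stopped_result:
  fixes B S :: "'a::euclidean_space set"
  assumes "interior S \<noteq> {}" and inv: "run_invariant B S n st" and "stopped st"
  shows "fst st = convex hull (B \<union> S)"
proof (rule eq_if_facet_halfspaces_contain)
  have "S \<subseteq> fst st" using inv by (auto simp: run_invariant_def)
  then show "interior (fst st) \<noteq> {}" using assms(1) interior_mono by blast
  show "polytope (fst st)" "fst st \<subseteq> convex hull (B \<union> S)"
    using inv by (auto simp: run_invariant_def)
  have marked: "snd st \<subseteq> facet_halfspaces (convex hull (B \<union> S))"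
    using inv by (auto simp: run_invariant_def)
  show "convex hull (B \<union> S) \<subseteq> H" if "H \<in> facet_halfspaces (fst st)" for H
  proof -
    have "H \<in> facet_halfspaces (convex hull (B \<union> S))"
      using that \<open>stopped st\<close> marked unfolding stopped_def by blast
    then show ?thesis by (simp add: facet_halfspaces_iff)
  qed
qed (rule convex_convex_hull)

theorem theorem7:
  fixes S B :: "(real ^ 'p) set"
  assumes "polytope S" and "interior S \<noteq> {}"
    and "polytope B" and "interior B \<noteq> {}"
  shows "\<not> (\<exists>\<sigma>. \<sigma> 0 = initial_state S \<and> (\<forall>i::nat. approx_step B (\<sigma> i) (\<sigma> (Suc i)))) \<and>
    (\<forall>n st. (approx_step B ^^ n) (initial_state S) st \<longrightarrow>
       (stopped st \<or> (\<exists>st'. approx_step B st st')) \<and>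
       (stopped st \<longrightarrow> fst st = convex hull (B \<union> S)) \<and>
       n \<le> card {x. x extreme_point_of B} + card {F. F facet_of (convex hull (B \<union> S))})"
proof (intro conjI allI impI)
  let ?N = "card {x. x extreme_point_of B} + card {F. F facet_of (convex hull (B \<union> S))}"
  note steps = run_invariant_steps[OF assms(3,1,2)]
  note bound = run_invariant_bound[OF assms(3,1,2)]
  show "\<not> (\<exists>\<sigma>. \<sigma> 0 = initial_state S \<and> (\<forall>i::nat. approx_step B (\<sigma> i) (\<sigma> (Suc i))))"
  proof
    assume "\<exists>\<sigma>. \<sigma> 0 = initial_state S \<and> (\<forall>i::nat. approx_step B (\<sigma> i) (\<sigma> (Suc i)))"
    then obtain \<sigma> where "\<sigma> 0 = initial_state S" "\<And>i::nat. approx_step B (\<sigma> i) (\<sigma> (Suc i))"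
      by blast
    then have "(approx_step B ^^ n) (initial_state S) (\<sigma> n)" for n
      by (induction n) auto
    then have "Suc ?N \<le> ?N" using bound steps by blast
    then show False by simp
  qed
  fix n st
  assume run: "(approx_step B ^^ n) (initial_state S) st"
  show "stopped st \<or> (\<exists>st'. approx_step B st st')" using step_if_not_stopped[OF assms(3)] by blast
  show "fst st = convex hull (B \<union> S)" if "stopped st"
    using stopped_result[OF assms(2) steps[OF run] that] .
  show "n \<le> ?N" using bound[OF steps[OF run]] .
qed

end
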